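(* Let $\preceq$ be a linear order on the set $\mathbb{P}$ of primes. Let $A \subseteq \{2,3,4,\ldots\}$ be $L$-primitive with respect to $\preceq$. Let $f$ be a completely multiplicative arithmetic function with $0 \le f(p) \le 1$ for every prime $p$. Then \[ \sum_{a \in A} f(a) \prod_{p \prec P'(a)} \bigl(1 - f(p)\bigr) \le 1, \] where the product runs over primes $p$ strictly $\preceq$-smaller than $P'(a)$.
   Context: For $n \ge 2$, let $p'(n)$ and $P'(n)$ denote the $\preceq$-minimal and $\preceq$-maximal prime divisors of $n$; set $p'(1) = +\infty$, meaning that $P'(a) \preceq p'(1)$ holds for every $a$. For $a \ge 2$ let $L_a = \{ab : b \in \mathbb{N},\ P'(a) \preceq p'(b)\}$ (so $a \in L_a$). A set $A$ is $L$-primitive with respect to $\preceq$ if $a' \notin L_a$ for all distinct $a, a' \in A$. *)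

theory Defs
  imports "HOL-Analysis.Analysis" "HOL-Computational_Algebra.Primes"
begin

text \<open>
  A linear order on the primes is given as a relation \<open>r\<close>, with \<open>(p, q) \<in> r\<close> meaning that
  \<open>p\<close> precedes or equals \<open>q\<close>.  The following two are meaningful for \<open>n \<ge> 2\<close> and \<open>r\<close>
  satisfying \<open>linear_order_on {p. prime p} r\<close>; see \<open>min_prime_divisor_props\<close> and
  \<open>max_prime_divisor_props\<close>.
\<close>

definition min_prime_divisor :: "nat rel \<Rightarrow> nat \<Rightarrow> nat" where
  "min_prime_divisor r n =
     (THE p. prime p \<and> p dvd n \<and> (\<forall>q. prime q \<and> q dvd n \<longrightarrow> (p, q) \<in> r))"

definition max_prime_divisor :: "nat rel \<Rightarrow> nat \<Rightarrow> nat" where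
  "max_prime_divisor r n =
     (THE p. prime p \<and> p dvd n \<and> (\<forall>q. prime q \<and> q dvd n \<longrightarrow> (q, p) \<in> r))"

text \<open>The disjunct \<open>b = 1\<close> is the convention that the least prime divisor of 1 is \<open>+\<infinity>\<close>.\<close>

definition le_min_prime_divisor :: "nat rel \<Rightarrow> nat \<Rightarrow> nat \<Rightarrow> bool" where
  "le_min_prime_divisor r p b \<longleftrightarrow> b = 1 \<or> (p, min_prime_divisor r b) \<in> r"

definition L_multiples :: "nat rel \<Rightarrow> nat \<Rightarrow> nat set" where
  "L_multiples r a = {a * b | b. b \<ge> 1 \<and> le_min_prime_divisor r (max_prime_divisor r a) b}"

definition L_primitive :: "nat rel \<Rightarrow> nat set \<Rightarrow> bool" where
  "L_primitive r A \<longleftrightarrow> (\<forall>a\<in>A. \<forall>a'\<in>A. a \<noteq> a' \<longrightarrow> a' \<notin> L_multiples r a)"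

text \<open>Arithmetic functions live on the positive integers, so the value at 0 is unconstrained.\<close>

definition completely_multiplicative :: "(nat \<Rightarrow> real) \<Rightarrow> bool" where
  "completely_multiplicative f \<longleftrightarrow>
     f 1 = 1 \<and> (\<forall>m n. m \<ge> 1 \<longrightarrow> n \<ge> 1 \<longrightarrow> f (m * n) = f m * f n)"

text \<open>
  Unordered infinite product, in analogy to \<^const>\<open>infsum\<close>.  Unlike \<^const>\<open>prodinf\<close>, it has the
  value 0 when the finite partial products tend to 0.  For factors in \<open>[0, 1]\<close> the limit
  always exists; see \<open>tendsto_infprod\<close>.
\<close>

definition infprod :: "('a \<Rightarrow> real) \<Rightarrow> 'a set \<Rightarrow> real" where
  "infprod g S = Lim (finite_subsets_at_top S) (prod g)"

definition smaller_primes :: "nat rel \<Rightarrow> nat \<Rightarrow> nat set" where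
  "smaller_primes r q = {p. prime p \<and> (p, q) \<in> r \<and> p \<noteq> q}"

lemma finite_linear_order_least:
  assumes "linear_order_on P r" "finite B" "B \<noteq> {}" "B \<subseteq> P"
  shows "\<exists>p\<in>B. \<forall>q\<in>B. (p, q) \<in> r"
  using assms(2-4)
proof (induction B rule: finite_ne_induct)
  case (singleton x)
  then show ?case
    using assms(1) by (auto simp: order_on_defs refl_on_def)
next
  case (insert x F)
  then obtain p where p: "p \<in> F" "\<forall>q\<in>F. (p, q) \<in> r" by auto
  have xP: "x \<in> P" and pP: "p \<in> P" using insert p by auto
  have refl: "(x, x) \<in> r" and tr: "trans r"
    using assms(1) xP by (auto simp: order_on_defs refl_on_def)
  have "(x, p) \<in> r \<or> (p, x) \<in> r"
    using assms(1) xP pP refl by (cases "x = p") (auto simp: order_on_defs total_on_def)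
  then show ?case
  proof
    assume "(x, p) \<in> r"
    then have "\<forall>q\<in>insert x F. (x, q) \<in> r" using p(2) tr refl by (auto dest: transD)
    then show ?thesis by blast
  next
    assume "(p, x) \<in> r"
    then show ?thesis using p by blast
  qed
qed

lemma min_prime_divisor_props:
  assumes r: "linear_order_on {p. prime p} r" and n: "n \<ge> 2"
  shows "prime (min_prime_divisor r n)" "min_prime_divisor r n dvd n"
    "\<And>q. prime q \<Longrightarrow> q dvd n \<Longrightarrow> (min_prime_divisor r n, q) \<in> r"
proof -
  let ?B = "{q. prime q \<and> q dvd n}"
  have "finite ?B" using n by (auto intro: finite_subset[of _ "{..n}"] dest: dvd_imp_le)
  moreover have "?B \<noteq> {}" using n prime_factor_nat[of n] by auto
  ultimately have ex: "\<exists>p\<in>?B. \<forall>q\<in>?B. (p, q) \<in> r"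
    by (intro finite_linear_order_least[OF r]) auto
  have anti: "antisym r" using r by (simp add: order_on_defs)
  have "\<exists>!p. prime p \<and> p dvd n \<and> (\<forall>q. prime q \<and> q dvd n \<longrightarrow> (p, q) \<in> r)"
    using ex anti by (auto dest: antisymD)
  from theI'[OF this] show "prime (min_prime_divisor r n)" "min_prime_divisor r n dvd n"
    "\<And>q. prime q \<Longrightarrow> q dvd n \<Longrightarrow> (min_prime_divisor r n, q) \<in> r"
    unfolding min_prime_divisor_def by blast+
qed

lemma max_prime_divisor_eq: "max_prime_divisor r n = min_prime_divisor (r\<inverse>) n"
  by (simp add: max_prime_divisor_def min_prime_divisor_def)

lemma max_prime_divisor_props:
  assumes r: "linear_order_on {p. prime p} r" and n: "n \<ge> 2"
  shows "prime (max_prime_divisor r n)" "max_prime_divisor r n dvd n"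
    "\<And>q. prime q \<Longrightarrow> q dvd n \<Longrightarrow> (q, max_prime_divisor r n) \<in> r"
proof -
  have "linear_order_on {p. prime p} (r\<inverse>)" using r by simp
  from min_prime_divisor_props[OF this n]
  show "prime (max_prime_divisor r n)" "max_prime_divisor r n dvd n"
    "\<And>q. prime q \<Longrightarrow> q dvd n \<Longrightarrow> (q, max_prime_divisor r n) \<in> r"
    by (auto simp: max_prime_divisor_eq)
qed

lemma infprod_finite:
  assumes "finite S"
  shows "infprod g S = prod g S"
proof -
  have "eventually (\<lambda>F. prod g S = prod g F) (finite_subsets_at_top S)"
    using assms by (auto simp: eventually_finite_subsets_at_top intro!: exI[of _ S])
  then have "(prod g \<longlongrightarrow> prod g S) (finite_subsets_at_top S)"
    by (rule Lim_transform_eventually[OF tendsto_const])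
  then show ?thesis
    unfolding infprod_def by (intro tendsto_Lim) auto
qed

lemma tendsto_infprod:
  assumes g: "\<And>x. x \<in> S \<Longrightarrow> 0 \<le> g x \<and> g x \<le> 1"
  shows "(prod g \<longlongrightarrow> infprod g S) (finite_subsets_at_top S)"
proof -
  define I where "I = Inf (prod g ` {F. finite F \<and> F \<subseteq> S})"
  have bdd: "bdd_below (prod g ` {F. finite F \<and> F \<subseteq> S})"
    using g by (intro bdd_belowI[of _ 0]) (auto intro!: prod_nonneg)
  have "(prod g \<longlongrightarrow> I) (finite_subsets_at_top S)"
  proof (rule order_tendstoI)
    fix a assume "a < I"
    moreover have "I \<le> prod g F" if "finite F" "F \<subseteq> S" for F
      unfolding I_def using that by (intro cInf_lower bdd) auto
    ultimately show "eventually (\<lambda>F. a < prod g F) (finite_subsets_at_top S)"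
      by (intro eventually_finite_subsets_at_top_weakI) force
  next
    fix a assume "I < a"
    then obtain F where F: "finite F" "F \<subseteq> S" "prod g F < a"
      unfolding I_def using cInf_lessD[of "prod g ` {F. finite F \<and> F \<subseteq> S}" a] by auto
    have "prod g G \<le> prod g F" if "finite G" "F \<subseteq> G" "G \<subseteq> S" for G
    proof -
      have "prod g G = prod g F * prod g (G - F)"
        using that F by (metis prod.subset_diff mult.commute)
      also have "\<dots> \<le> prod g F * 1"
        using that F g by (intro mult_left_mono prod_le_1 prod_nonneg) auto
      finally show ?thesis by simp
    qed
    then show "eventually (\<lambda>F. prod g F < a) (finite_subsets_at_top S)"
      unfolding eventually_finite_subsets_at_top using F by (intro exI[of _ F]) force
  qed
  then show ?thesis
    unfolding infprod_def by (subst tendsto_Lim) auto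
qed

end

theory Submission
  imports Defs
begin

text \<open>
  Writing an integer as the \<open>r\<close>-increasing word of its prime factors, \<open>L_multiples r a\<close> consists of
  the words with prefix \<open>a\<close>, so that an \<open>L\<close>-primitive set is a prefix code and the theorem is a
  Kraft inequality.  Indeed the weights \<open>w a = f a * (\<Prod>p \<prec> P' a. 1 - f p)\<close> satisfy
  \<open>(\<Sum>q \<succeq> P' a. w (a * q)) \<le> w a\<close>, because \<open>\<Sum>q. f q * (\<Prod>p \<prec> q. 1 - f p)\<close> telescopes.
\<close>

section \<open>Extremal prime divisors and the prefix structure of
  \<open>L_multiples\<close>\<close>

lemma max_prime_divisor_eqI:
  assumes "linear_order_on {p. prime p} r" "n > 0" "prime p" "p dvd n"
    and "\<And>q. prime q \<Longrightarrow> q dvd n \<Longrightarrow> (q, p) \<in> r"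
  shows "max_prime_divisor r n = p"
proof -
  have "p \<le> n" using assms by (auto dest: dvd_imp_le)
  then have "n \<ge> 2" using prime_ge_2_nat[OF assms(3)] by simp
  note m = max_prime_divisor_props[OF assms(1) this]
  have "antisym r" using assms(1) by (simp add: order_on_defs)
  then show ?thesis using m assms(3-5) by (auto dest: antisymD)
qed

lemma max_prime_divisor_prime:
  assumes "linear_order_on {p. prime p} r" "prime p"
  shows "max_prime_divisor r p = p"
proof (rule max_prime_divisor_eqI[OF assms(1)])
  show "(q, p) \<in> r" if "prime q" "q dvd p" for q
    using that assms primes_dvd_imp_eq[of q p] by (auto simp: order_on_defs refl_on_def)
qed (use assms prime_gt_0_nat in auto)

lemma max_prime_divisor_mult_prime:
  assumes "linear_order_on {p. prime p} r" "a \<ge> 2" "prime q" "(max_prime_divisor r a, q) \<in> r"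
  shows "max_prime_divisor r (a * q) = q"
proof (rule max_prime_divisor_eqI[OF assms(1)])
  fix p assume p: "prime p" "p dvd a * q"
  then consider "p dvd a" | "p = q"
    using assms(3) by (auto simp: prime_dvd_mult_iff dest: primes_dvd_imp_eq)
  then show "(p, q) \<in> r"
  proof cases
    case 1
    have "trans r" using assms(1) by (simp add: order_on_defs)
    then show ?thesis
      using max_prime_divisor_props(3)[OF assms(1,2) p(1) 1] assms(4) by (auto dest: transD)
  qed (use assms in \<open>auto simp: order_on_defs refl_on_def\<close>)
qed (use assms prime_gt_0_nat in auto)

text \<open>For \<open>b = 1\<close> the right-hand side holds vacuously, so quantifying over prime
  divisors absorbs the convention for the least prime divisor of 1 and no later argument has to
  single it out.\<close>

lemma le_min_prime_divisor_iff:
  assumes "linear_order_on {p. prime p} r" "b \<ge> 1"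
  shows "le_min_prime_divisor r p b \<longleftrightarrow> (\<forall>q. prime q \<and> q dvd b \<longrightarrow> (p, q) \<in> r)"
proof (cases "b = 1")
  case False
  then have "b \<ge> 2" using assms(2) by simp
  note m = min_prime_divisor_props[OF assms(1) this]
  have "trans r" using assms(1) by (simp add: order_on_defs)
  then show ?thesis
    using m False by (auto simp: le_min_prime_divisor_def dest: transD)
qed (auto simp: le_min_prime_divisor_def)

lemma in_L_multiples_iff:
  assumes "linear_order_on {p. prime p} r"
  shows "c \<in> L_multiples r a \<longleftrightarrow>
    (\<exists>b\<ge>1. c = a * b \<and> (\<forall>q. prime q \<and> q dvd b \<longrightarrow> (max_prime_divisor r a, q) \<in> r))"
  using le_min_prime_divisor_iff[OF assms] by (auto simp: L_multiples_def)

lemma in_L_multiples_min_prime_divisor: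
  assumes r: "linear_order_on {p. prime p} r" and c: "c \<ge> 2"
  shows "c \<in> L_multiples r (min_prime_divisor r c)"
proof -
  note m = min_prime_divisor_props[OF r c]
  obtain b where b: "c = min_prime_divisor r c * b" using m(2) by (auto elim: dvdE)
  have "b \<ge> 1" using b c by (cases b) auto
  moreover have "(min_prime_divisor r c, q) \<in> r" if "prime q" "q dvd b" for q
    using m(3) that b by (metis dvd_mult)
  ultimately show ?thesis
    using b by (auto simp: in_L_multiples_iff[OF r] max_prime_divisor_prime[OF r m(1)])
qed

text \<open>If the word of \<open>a\<close> is a proper prefix of the word of \<open>c\<close>, then
  \<open>q\<close> is the next letter: the least prime divisor of the cofactor \<open>c / a\<close>.
  This is the branching of the prefix tree.\<close>

lemma L_multiples_next_prime:
  assumes r: "linear_order_on {p. prime p} r" and a: "a \<ge> 2"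
    and c: "c \<in> L_multiples r a" "c \<noteq> a"
  obtains q where "prime q" "q dvd c" "(max_prime_divisor r a, q) \<in> r"
    "c \<in> L_multiples r (a * q)"
proof -
  obtain b where b: "b \<ge> 1" "c = a * b"
    "\<And>q. prime q \<Longrightarrow> q dvd b \<Longrightarrow> (max_prime_divisor r a, q) \<in> r"
    using c(1) by (auto simp: in_L_multiples_iff[OF r])
  have b2: "b \<ge> 2" using b c(2) by (cases "b = 1") auto
  define q where "q = min_prime_divisor r b"
  have q: "prime q" "q dvd b" using min_prime_divisor_props[OF r b2] by (auto simp: q_def)
  \<comment> \<open>Which cofactors are admissible depends only on the last letter. Since
    \<open>q\<close> and \<open>a * q\<close> both end in \<open>q\<close>, the cofactor that puts
    \<open>b\<close> above \<open>q\<close> also puts \<open>c\<close> above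
    \<open>a * q\<close>.\<close>
  have "b \<in> L_multiples r q"
    using in_L_multiples_min_prime_divisor[OF r b2] by (simp add: q_def)
  moreover have "max_prime_divisor r (a * q) = max_prime_divisor r q"
    using max_prime_divisor_mult_prime[OF r a q(1) b(3)[OF q]] max_prime_divisor_prime[OF r q(1)]
    by simp
  ultimately have "c \<in> L_multiples r (a * q)"
    using b(2) by (auto simp: in_L_multiples_iff[OF r] mult.assoc)
  with q b show ?thesis by (intro that[of q]) auto
qed

lemma self_in_L_multiples:
  assumes "linear_order_on {p. prime p} r"
  shows "a \<in> L_multiples r a"
  by (auto simp: in_L_multiples_iff[OF assms] intro!: exI[of _ 1])

section \<open>Telescoping sums and the union bound\<close>

text \<open>For \<open>g\<close> with values in [0, 1], mark each \<open>x\<close> independently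
  with probability \<open>g x\<close>: a summand is the probability that \<open>x\<close> is the
  first marked element of \<open>S\<close>, and for this to lie in the up-closed set
  \<open>T\<close>, nothing in \<open>S - T\<close> may be marked. Algebraically, splitting off the
  least \<open>m\<close> of \<open>T\<close> leaves \<open>1 - g m\<close> times the product over
  \<open>S - T\<close>, and the summand of \<open>m\<close> supplies the missing \<open>g m\<close>
  times that product. Only the case \<open>T = {}\<close> loses anything, namely the product over
  all of \<open>S\<close>, nonnegative because \<open>g x \<le> 1\<close>.\<close>

lemma sum_mult_prod_less_le:
  fixes g :: "'a \<Rightarrow> real"
  assumes r: "linear_order_on P r" and S: "finite S" "S \<subseteq> P" and "T \<subseteq> S"
    and "\<And>x y. x \<in> T \<Longrightarrow> y \<in> S \<Longrightarrow> (x, y) \<in> r \<Longrightarrow> y \<in> T"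
    and g: "\<And>x. x \<in> S \<Longrightarrow> g x \<le> 1"
  shows "(\<Sum>x\<in>T. g x * (\<Prod>y | y \<in> S \<and> (y, x) \<in> r \<and> y \<noteq> x. 1 - g y)) \<le> (\<Prod>y\<in>S - T. 1 - g y)"
    (is "sum ?h T \<le> _")
proof -
  have "finite T" using S \<open>T \<subseteq> S\<close> by (auto intro: finite_subset)
  then show ?thesis using assms(4,5)
  proof (induction T rule: finite_psubset_induct)
    case (psubset T)
    show ?case
    proof (cases "T = {}")
      case True
      then show ?thesis using g by (auto intro!: prod_nonneg)
    next
      case False
      have "T \<subseteq> P" using psubset.prems(1) S(2) by blast
      then obtain m where m: "m \<in> T" "\<forall>x\<in>T. (m, x) \<in> r"
        using finite_linear_order_least[OF r psubset.hyps False] by blast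
      have anti: "antisym r" and tot: "total_on P r"
        using r by (auto simp: order_on_defs)
      \<comment> \<open>An element of \<open>S\<close> that is not below \<open>m\<close> lies above
        it by totality, hence in \<open>T\<close> by up-closedness.\<close>
      have below: "{y. y \<in> S \<and> (y, m) \<in> r \<and> y \<noteq> m} = S - T"
      proof (intro equalityI subsetI)
        fix y assume "y \<in> {y. y \<in> S \<and> (y, m) \<in> r \<and> y \<noteq> m}"
        then show "y \<in> S - T" using m anti by (auto dest: antisymD)
      next
        fix y assume y: "y \<in> S - T"
        then have "(m, y) \<notin> r" "y \<noteq> m" using psubset.prems(2)[OF m(1)] m(1) by auto
        moreover have "y \<in> P" "m \<in> P" using y S(2) \<open>T \<subseteq> P\<close> m(1) by auto
        ultimately show "y \<in> {y. y \<in> S \<and> (y, m) \<in> r \<and> y \<noteq> m}"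
          using y tot by (auto simp: total_on_def)
      qed
      have "y \<in> T - {m}" if "x \<in> T - {m}" "y \<in> S" "(x, y) \<in> r" for x y
        using that psubset.prems(2)[of x y] m anti by (auto dest: antisymD)
      then have IH: "sum ?h (T - {m}) \<le> (\<Prod>y\<in>S - (T - {m}). 1 - g y)"
      proof (intro psubset.IH)
        show "T - {m} \<subset> T" "T - {m} \<subseteq> S" using psubset.prems(1) m(1) by auto
      qed
      have "S - (T - {m}) = insert m (S - T)" using m(1) psubset.prems(1) by auto
      then have "(\<Prod>y\<in>S - (T - {m}). 1 - g y) = (1 - g m) * (\<Prod>y\<in>S - T. 1 - g y)"
        using m(1) S by simp
      then show ?thesis
        using IH below by (simp add: sum.remove[OF psubset.hyps m(1)] algebra_simps)
    qed
  qed
qed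

text \<open>A union bound for one node of the tree: the \<open>D q\<close> are the branches below
  \<open>C\<close>, \<open>v q\<close> bounds the weight found in branch \<open>q\<close>, and
  nonnegativity of \<open>w\<close> takes care of overlaps.\<close>

lemma kraft_step:
  fixes w :: "nat \<Rightarrow> real"
  assumes "finite F" "finite T"
    and "F \<inter> C \<subseteq> (\<Union>q\<in>T. F \<inter> D q)"
    and "\<And>c. c \<in> F \<Longrightarrow> 0 \<le> w c"
    and "\<And>q. q \<in> T \<Longrightarrow> sum w (F \<inter> D q) \<le> v q"
  shows "sum w (F \<inter> C) \<le> sum v T"
proof -
  have "sum w (F \<inter> C) \<le> sum w (\<Union>q\<in>T. F \<inter> D q)"
    using assms by (intro sum_mono2) auto
  also have "\<dots> \<le> (\<Sum>q\<in>T. sum w (F \<inter> D q))"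
    using assms(2)
  proof (induction T rule: finite_induct)
    case (insert q T)
    have "0 \<le> sum w (F \<inter> D q \<inter> (\<Union>q\<in>T. F \<inter> D q))"
      using assms(4) by (intro sum_nonneg) auto
    then have "sum w (F \<inter> D q \<union> (\<Union>q\<in>T. F \<inter> D q))
        \<le> sum w (F \<inter> D q) + sum w (\<Union>q\<in>T. F \<inter> D q)"
      using assms(1) insert.hyps by (subst sum_Un) auto
    then show ?case using insert by simp
  qed simp
  also have "\<dots> \<le> sum v T"
    using assms(5) by (rule sum_mono)
  finally show ?thesis .
qed

section \<open>Signs of the weights and bounds for infinite products\<close>

lemma completely_multiplicative_nonneg:
  assumes "completely_multiplicative f" "\<And>p. prime p \<Longrightarrow> 0 \<le> f p" "n > 0"
  shows "0 \<le> f n"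
  using assms(3)
proof (induction n rule: less_induct)
  case (less n)
  show ?case
  proof (cases "n = 1")
    case False
    then obtain p k where p: "prime p" "n = p * k" using prime_factor_nat[of n] by auto
    then have "k > 0" "k < n" using less.prems prime_gt_1_nat[of p] by auto
    then have "0 \<le> f k" "f n = f p * f k"
      using less.IH assms(1) p prime_gt_0_nat[of p]
      by (auto simp: completely_multiplicative_def)
    then show ?thesis using assms(2)[OF p(1)] by simp
  qed (use assms in \<open>simp add: completely_multiplicative_def\<close>)
qed

text \<open>With factors in [0, 1], finite products decrease under inclusion, so their limit lies
  below each of them.\<close>

lemma infprod_le_prod:
  assumes g: "\<And>x. x \<in> S \<Longrightarrow> 0 \<le> g x \<and> g x \<le> 1" and F: "finite F" "F \<subseteq> S"
  shows "infprod g S \<le> prod g F"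
proof (rule tendsto_upperbound[OF tendsto_infprod[OF g]])
  have "prod g G \<le> prod g F" if "finite G" "F \<subseteq> G" "G \<subseteq> S" for G
  proof -
    have "prod g G = prod g F * prod g (G - F)"
      using that by (metis prod.subset_diff mult.commute)
    also have "\<dots> \<le> prod g F * 1"
      using that F g by (intro mult_left_mono prod_le_1 prod_nonneg) auto
    finally show ?thesis by simp
  qed
  then show "eventually (\<lambda>G. prod g G \<le> prod g F) (finite_subsets_at_top S)"
    unfolding eventually_finite_subsets_at_top using F by blast
qed auto

lemma infprod_nonneg:
  assumes "\<And>x. x \<in> S \<Longrightarrow> 0 \<le> g x \<and> g x \<le> 1"
  shows "0 \<le> infprod g S"
proof (rule tendsto_lowerbound[OF tendsto_infprod[OF assms]])
  show "eventually (\<lambda>F. 0 \<le> prod g F) (finite_subsets_at_top S)"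
    using assms by (intro eventually_finite_subsets_at_top_weakI prod_nonneg) auto
qed auto

section \<open>The inequality for finite sets\<close>

text \<open>The products are cut down to a finite set \<open>S\<close> of primes containing every
  letter that occurs in \<open>F\<close>. Each node of the tree then has finitely many relevant
  branches, and the telescoping lemma applies.\<close>

lemma L_primitive_finite_sum_le:
  fixes f :: "nat \<Rightarrow> real"
  defines "w \<equiv> \<lambda>S r a. f a * (\<Prod>p | p \<in> S \<and> (p, max_prime_divisor r a) \<in> r \<and>
                                        p \<noteq> max_prime_divisor r a. 1 - f p)"
  assumes r: "linear_order_on {p. prime p} r" and F: "finite F" "F \<subseteq> {2..}" "L_primitive r F"
    and f: "completely_multiplicative f" "\<And>p. prime p \<Longrightarrow> 0 \<le> f p \<and> f p \<le> 1"
    and S: "finite S" "S \<subseteq> {p. prime p}" "\<And>a p. a \<in> F \<Longrightarrow> prime p \<Longrightarrow> p dvd a \<Longrightarrow> p \<in> S"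
  shows "(\<Sum>a\<in>F. w S r a) \<le> 1"
proof -
  have w_nonneg: "0 \<le> w S r a" if "a > 0" for a
    unfolding w_def using completely_multiplicative_nonneg[OF f(1) _ that] f(2) S(2)
    by (intro mult_nonneg_nonneg prod_nonneg) auto
  have F_pos: "a > 0" if "a \<in> F" for a using that F(2) by auto
  have tr: "trans r" and anti: "antisym r" and tot: "total_on {p. prime p} r"
    and rfl: "\<And>p. prime p \<Longrightarrow> (p, p) \<in> r"
    using r by (auto simp: order_on_defs refl_on_def)
  let ?below = "\<lambda>q. \<Prod>p | p \<in> S \<and> (p, q) \<in> r \<and> p \<noteq> q. 1 - f p"
  \<comment> \<open>The induction goes from long words to short ones. A node in \<open>F\<close> is
    a leaf by \<open>L\<close>-primitivity. The measure is a truncated subtraction, which drops from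
    \<open>a\<close> to \<open>a * q\<close> only while \<open>a < Max F\<close>; nodes from
    \<open>Max F\<close> on that are not in \<open>F\<close> have no element of \<open>F\<close>
    above them.\<close>
  have subtree: "sum (w S r) (F \<inter> L_multiples r a) \<le> w S r a" if "a \<ge> 2" for a
    using that
  proof (induction "Max F - a" arbitrary: a rule: less_induct)
    case less
    consider "a \<in> F" | "a \<notin> F" "Max F \<le> a" | "a \<notin> F" "a < Max F" by linarith
    then show ?case
    proof cases
      case 1
      then have "F \<inter> L_multiples r a = {a}"
        using F(3) self_in_L_multiples[OF r] by (auto simp: L_primitive_def)
      then show ?thesis by simp
    next
      case 2
      have "c \<notin> L_multiples r a" if "c \<in> F" for c
      proof
        assume "c \<in> L_multiples r a"
        then have "a \<le> c" by (auto simp: L_multiples_def)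
        moreover have "c \<le> Max F" using that F(1) by simp
        ultimately have "c = a" using 2 by linarith
        then show False using 2 that by simp
      qed
      then have "F \<inter> L_multiples r a = {}" by auto
      then show ?thesis using w_nonneg[of a] less.prems by simp
    next
      case 3
      let ?P = "max_prime_divisor r a"
      note P = max_prime_divisor_props[OF r less.prems]
      \<comment> \<open>The letters of \<open>S\<close> that may follow the word of
        \<open>a\<close>; this set is up-closed in \<open>S\<close>.\<close>
      define T where "T = {q \<in> S. (?P, q) \<in> r}"
      have "sum (w S r) (F \<inter> L_multiples r a) \<le> (\<Sum>q\<in>T. w S r (a * q))"
      proof (rule kraft_step[where D = "\<lambda>q. L_multiples r (a * q)"])
        show "F \<inter> L_multiples r a \<subseteq> (\<Union>q\<in>T. F \<inter> L_multiples r (a * q))"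
        proof
          fix c assume c: "c \<in> F \<inter> L_multiples r a"
          then have "c \<noteq> a" using 3 by auto
          with c obtain q where "prime q" "q dvd c" "(?P, q) \<in> r" "c \<in> L_multiples r (a * q)"
            using L_multiples_next_prime[OF r less.prems] by blast
          then show "c \<in> (\<Union>q\<in>T. F \<inter> L_multiples r (a * q))"
            using c S(3) by (auto simp: T_def)
        qed
        fix q assume "q \<in> T"
        then have "q > 1" using S(2) prime_gt_1_nat by (auto simp: T_def)
        then have "a < a * q" using less.prems by simp
        then show "sum (w S r) (F \<inter> L_multiples r (a * q)) \<le> w S r (a * q)"
          using 3 less.prems by (intro less.hyps) linarith+
      qed (use F S w_nonneg F_pos in \<open>auto simp: T_def\<close>)
      also have "\<dots> = (\<Sum>q\<in>T. f a * (f q * ?below q))"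
      proof (rule sum.cong[OF refl])
        fix q assume "q \<in> T"
        then have q: "prime q" "(?P, q) \<in> r" using S(2) by (auto simp: T_def)
        then have "f (a * q) = f a * f q"
          using f(1) less.prems prime_gt_0_nat[of q] by (auto simp: completely_multiplicative_def)
        then show "w S r (a * q) = f a * (f q * ?below q)"
          using max_prime_divisor_mult_prime[OF r less.prems q] by (simp add: w_def mult_ac)
      qed
      also have "\<dots> = f a * (\<Sum>q\<in>T. f q * ?below q)" by (simp add: sum_distrib_left)
      also have "\<dots> \<le> f a * (\<Prod>p\<in>S - T. 1 - f p)"
      proof (intro mult_left_mono sum_mult_prod_less_le[OF r S(1,2)])
        show "y \<in> T" if "x \<in> T" "y \<in> S" "(x, y) \<in> r" for x y
          using that tr by (auto simp: T_def dest: transD)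
        show "0 \<le> f a" using completely_multiplicative_nonneg[OF f(1)] f(2) less.prems by auto
      qed (use f S in \<open>auto simp: T_def\<close>)
      \<comment> \<open>By totality the letters that may not follow are those strictly below
        \<open>?P\<close>, so the telescoped bound is exactly \<open>w S r a\<close>.\<close>
      also have "S - T = {p. p \<in> S \<and> (p, ?P) \<in> r \<and> p \<noteq> ?P}"
      proof (rule set_eqI)
        fix p
        show "p \<in> S - T \<longleftrightarrow> p \<in> {p. p \<in> S \<and> (p, ?P) \<in> r \<and> p \<noteq> ?P}"
        proof (cases "p \<in> S")
          case True
          then have "prime p" using S(2) by auto
          then have "(?P, p) \<notin> r \<longleftrightarrow> (p, ?P) \<in> r \<and> p \<noteq> ?P"
            using anti rfl[OF P(1)] tot P(1) unfolding total_on_def by (auto dest: antisymD)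
          then show ?thesis using True by (simp add: T_def)
        qed auto
      qed
      finally show ?thesis by (simp add: w_def)
    qed
  qed
  \<comment> \<open>The root of the tree is the empty word, that is 1, which has no last letter and
    is treated separately: every letter of \<open>S\<close> may come first, and the telescoped bound
    is the empty product.\<close>
  have "sum (w S r) (F \<inter> UNIV) \<le> (\<Sum>q\<in>S. f q * ?below q)"
  proof (rule kraft_step[where D = "L_multiples r"])
    show "F \<inter> UNIV \<subseteq> (\<Union>q\<in>S. F \<inter> L_multiples r q)"
    proof
      fix c assume c: "c \<in> F \<inter> UNIV"
      then have c2: "c \<ge> 2" using F(2) by auto
      have "min_prime_divisor r c \<in> S"
        using c S(3) min_prime_divisor_props(1,2)[OF r c2] by simp
      then show "c \<in> (\<Union>q\<in>S. F \<inter> L_multiples r q)"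
        using c in_L_multiples_min_prime_divisor[OF r c2] by blast
    qed
    fix q assume "q \<in> S"
    then have "prime q" using S(2) by auto
    then show "sum (w S r) (F \<inter> L_multiples r q) \<le> f q * ?below q"
      using subtree[of q] max_prime_divisor_prime[OF r] prime_ge_2_nat by (simp add: w_def)
  qed (use F S w_nonneg F_pos in auto)
  also have "\<dots> \<le> (\<Prod>p\<in>S - S. 1 - f p)"
    using f(2) S by (intro sum_mult_prod_less_le[OF r]) auto
  finally show ?thesis by simp
qed

section \<open>Passage to arbitrary sets and infinite products\<close>

theorem theorem1:
  fixes r :: "nat rel" and A :: "nat set" and f :: "nat \<Rightarrow> real"
  assumes "linear_order_on {p. prime p} r"
    and "A \<subseteq> {2..}"
    and "L_primitive r A"
    and "completely_multiplicative f"
    and "\<And>p. prime p \<Longrightarrow> 0 \<le> f p \<and> f p \<le> 1"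
  shows "(\<lambda>a. f a * infprod (\<lambda>p. 1 - f p) (smaller_primes r (max_prime_divisor r a))) summable_on A \<and>
    (\<Sum>\<^sub>\<infinity>a\<in>A. f a * infprod (\<lambda>p. 1 - f p) (smaller_primes r (max_prime_divisor r a))) \<le> 1"
    (is "?u summable_on A \<and> _")
proof -
  have f_nonneg: "0 \<le> f a" if "a \<in> A" for a
  proof (rule completely_multiplicative_nonneg[OF assms(4)])
    show "a > 0" using that assms(2) by auto
  qed (use assms(5) in auto)
  have u_nonneg: "0 \<le> ?u a" if "a \<in> A" for a
    using f_nonneg[OF that] assms(5)
    by (intro mult_nonneg_nonneg infprod_nonneg) (auto simp: smaller_primes_def)
  have bound: "sum ?u F \<le> 1" if F: "finite F" "F \<subseteq> A" for F
  proof -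
    \<comment> \<open>All letters used by \<open>F\<close>. Restricting each product to
      \<open>S\<close> can only enlarge it, so the truncated weights dominate the true ones.\<close>
    define S where "S = (\<Union>a\<in>F. {p. prime p \<and> p dvd a})"
    have "finite {p. prime p \<and> p dvd a}" if "a \<in> F" for a
    proof (rule finite_subset)
      have "a > 0" using that F(2) assms(2) by auto
      then show "{p. prime p \<and> p dvd a} \<subseteq> {..a}" by (auto intro: dvd_imp_le)
    qed simp
    then have S: "finite S" "S \<subseteq> {p. prime p}" using F(1) by (auto simp: S_def)
    have "sum ?u F \<le> (\<Sum>a\<in>F. f a * (\<Prod>p | p \<in> S \<and> (p, max_prime_divisor r a) \<in> r \<and>
                                  p \<noteq> max_prime_divisor r a. 1 - f p))"
      using f_nonneg F S assms(5)
      by (intro sum_mono mult_left_mono infprod_le_prod) (auto simp: smaller_primes_def)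
    also have "\<dots> \<le> 1"
    proof (rule L_primitive_finite_sum_le)
      show "L_primitive r F" using F(2) assms(3) unfolding L_primitive_def by blast
    qed (use F assms S in \<open>auto simp: S_def\<close>)
    finally show ?thesis .
  qed
  have "?u summable_on A"
    using u_nonneg bound by (intro nonneg_bdd_above_summable_on bdd_aboveI[of _ 1]) auto
  then show ?thesis using bound infsum_le_finite_sums by blast
qed

end
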